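(* Let $\mathscr{E}=(\mathcal{X},\mathcal{Z},\mathcal{Y},\pi,G)$ be a fiber bundle representation of $\mathcal{X}$ with a local trivialization $\{(V_j,\psi_j):j\in J\}$ and compact $\mathcal{Y}$. For each $x\in\mathcal{X}$ with $z=\pi(x)\in V_j$, let $f_\phi$ be given by $$f_\phi(x)=C\cdot g\Big(\phi\big(\psi_{j,z}^{-1}(x),z\big)\Big),$$ where (i) $C=1/\nu(\mathcal{Y})$ is the density of the uniform distribution with respect to a measure $\nu$ on $\mathcal{Y}$; (ii) $g$ is the density of a probability distribution on $\mathcal{Z}$ with respect to a base measure $\mu$ with modular character $\Psi_\mu$; (iii) $\phi:\mathcal{Y}\times\mathcal{Z}\to\mathcal{Z}$ is such that $\phi_y:=\phi(y,\cdot)\in\Delta(\mathcal{Z})$ for each $y\in\mathcal{Y}$. Then $\{f_\phi:\phi\in\Phi\}$ admits $\mathfrak{F}$-equivalence when $$\Phi\subseteq\left\{\phi:\int_{\mathcal{Y}}C\cdot\Psi_\mu\big(|\det\mathbf{D}\phi_y^{-1}|\big)\,d\nu(y)=1\right\},$$ where $\phi_y^{-1}=\phi^{-1}(y,\cdot)$ is the inverse of $\phi_y$.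
   Context: Standing assumptions: $\mathcal{X}$ either contains an open subset of $\mathbb{R}^d$ or is a compact $d$-dimensional $\mathcal{C}^1$-manifold. $\mathbf{D}h$ denotes the Jacobian of $h$. $\mathfrak{F}$-equivalence: distributions with densities $f_1$ and $f_2$ are $\mathfrak{F}$-equivalent if $f_1(X)$ and $f_2(Y)$ are equal in distribution, where $X$ has density $f_1$ and $Y$ has density $f_2$. A family admits $\mathfrak{F}$-equivalence if every two members are $\mathfrak{F}$-equivalent. $\Delta(\mathcal{Z})$ is the set of diffeomorphisms $\varphi$ of $\mathcal{Z}$ for which $|\det\mathbf{D}\varphi(z)|$ does not depend on $z\in\mathcal{Z}$; this constant is written $|\det\mathbf{D}\varphi|$. Modular character: $\Psi_\mu$ is the modular character of the measure $\mu$ on $\mathcal{Z}$ if for each $\varphi\in\Delta(\mathcal{Z})$, with $u=\varphi(z)$, $\mu(du)=\Psi_\mu(|\det\mathbf{D}\varphi|)\,\mu(dz)$, i.e. $\mu(\varphi(B))=\Psi_\mu(|\det\mathbf{D}\varphi|)\mu(B)$ for measurable $B$. Fiber bundle $(\mathcal{X},\mathcal{Z},\mathcal{Y},\pi,G)$: $\mathcal{X}$ is the total space, $\mathcal{Z}$ the base space, $\pi:\mathcal{X}\to\mathcal{Z}$ a continuous surjection, $\mathcal{Y}$ the typical fiber, and $G$ a topological group (structure group) acting on $\mathcal{Y}$. A local trivialization is a collection $\{(V_j,\psi_j):j\in J\}$ where $\{V_j\}$ is an open cover of $\mathcal{Z}$ and each $\psi_j:V_j\times\mathcal{Y}\to\pi^{-1}(V_j)$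 is a diffeomorphism with $\pi(\psi_j(z,y))=z$; for $z\in V_j$ the map $\psi_{j,z}=\psi_j(z,\cdot):\mathcal{Y}\to\pi^{-1}(z)$ is a diffeomorphism; and for $z\in V_i\cap V_j$ the map $\psi_{j,z}^{-1}\circ\psi_{i,z}:\mathcal{Y}\to\mathcal{Y}$ coincides with the action of an element of $G$. Reference measure: $f_\phi$ is a density with respect to the local product measure $\lambda=\nu\otimes_{\mathrm{loc}}\mu$ on $\mathcal{X}$, given for measurable $A\subset\mathcal{X}$ with $\pi(A)\subset V_j$ by $\lambda(A)=\int_{\pi(A)}\nu_z(\pi^{-1}(z)\cap A)\,\mu(dz)$, where $\nu_z=(\psi_{j,z})_\#\nu$ is the pushforward of $\nu$ to the fiber $\pi^{-1}(z)$. It is assumed that $\nu$ is $G$-invariant, so that $\nu_z$ and $\lambda$ do not depend on the choice of trivialization.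
   Formalization: The base measure μ is assumed σ-finite (with counting measure on ℝ, Y=[0,1], g the indicator of 0 and φ(y,z)=z+y the function f_φ integrates to 0, so the claim fails), and the base space 𝒵 has dimension at least 1, so that the Jacobian is defined. *)

theory Defs
  imports "HOL-Probability.Probability" "HOL-Algebra.Group_Action"
begin

text \<open>
  A map on a set \<open>S\<close> that need not be open is of class C1 if near each point of \<open>S\<close> it is the
  restriction of a continuously differentiable map on an open set.  \<open>D\<close> is the derivative at \<open>x\<close>
  of such an extension; if \<open>S\<close> is contained in the closure of its interior, then \<open>D\<close> is uniquely
  determined by \<open>f\<close>, \<open>S\<close> and \<open>x\<close>.
\<close>

definition has_c1_jacobian ::
  "'a::euclidean_space set \<Rightarrow> ('a \<Rightarrow> 'b::euclidean_space) \<Rightarrow> 'a \<Rightarrow> ('a \<Rightarrow>\<^sub>L 'b) \<Rightarrow> bool"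
  where
  "has_c1_jacobian S f x D \<longleftrightarrow>
     (\<exists>W F F'. open W \<and> x \<in> W \<and>
        (\<forall>y\<in>W. (F has_derivative blinfun_apply (F' y)) (at y)) \<and>
        continuous_on W F' \<and>
        (\<forall>y\<in>S \<inter> W. F y = f y) \<and> D = F' x)"

definition c1_on :: "'a::euclidean_space set \<Rightarrow> ('a \<Rightarrow> 'b::euclidean_space) \<Rightarrow> bool" where
  "c1_on S f \<longleftrightarrow> (\<forall>x\<in>S. \<exists>D. has_c1_jacobian S f x D)"

text \<open>
  A space is a subset \<open>M\<close> of a second countable Hausdorff space (possibly the whole space),
  together with an atlas.  The images of the charts are not required to be open: manifolds
  (open images) and subsets of Euclidean space (identity chart) are both covered, as are finite
  sets and subsets such as the fibers of a bundle.
\<close>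

type_synonym ('a, 'e) chart = "'a set \<times> ('a \<Rightarrow> 'e)"

definition c1_space ::
  "'a::{second_countable_topology,t2_space} set \<Rightarrow> ('a, 'e::euclidean_space) chart set \<Rightarrow> bool"
  where
  "c1_space M A \<longleftrightarrow>
     (\<Union>(U, \<kappa>)\<in>A. U) = M \<and>
     (\<forall>(U, \<kappa>)\<in>A. openin (top_of_set M) U \<and> homeomorphism U (\<kappa> ` U) \<kappa> (inv_into U \<kappa>)) \<and>
     (\<forall>(U, \<kappa>)\<in>A. \<forall>(U', \<kappa>')\<in>A. c1_on (\<kappa> ` (U \<inter> U')) (\<kappa>' \<circ> inv_into U \<kappa>))"

definition c1_manifold ::
  "'a::{second_countable_topology,t2_space} set \<Rightarrow> ('a, 'e::euclidean_space) chart set \<Rightarrow> bool"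
  where
  "c1_manifold M A \<longleftrightarrow> c1_space M A \<and> (\<forall>(U, \<kappa>)\<in>A. open (\<kappa> ` U))"

text \<open>
  \<open>M\<close> is, through one global chart, a subset of the Euclidean space \<open>'e\<close> that contains a
  nonempty open set.
\<close>

definition contains_open_subset ::
  "'a::{second_countable_topology,t2_space} set \<Rightarrow> ('a, 'e::euclidean_space) chart set \<Rightarrow> bool"
  where
  "contains_open_subset M A \<longleftrightarrow>
     c1_space M A \<and> (\<exists>\<kappa>. (M, \<kappa>) \<in> A \<and> interior (\<kappa> ` M) \<noteq> {})"

text \<open>
  Regularity makes Jacobians in charts unique.  It holds for manifolds, with or without boundary.
\<close>

definition regular_charts :: "('a, 'e::euclidean_space) chart set \<Rightarrow> bool" where
  "regular_charts A \<longleftrightarrow> (\<forall>(U, \<kappa>)\<in>A. \<kappa> ` U \<subseteq> closure (interior (\<kappa> ` U)))"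

definition restrict_charts :: "'a set \<Rightarrow> ('a, 'e) chart set \<Rightarrow> ('a, 'e) chart set" where
  "restrict_charts S A = (\<lambda>(U, \<kappa>). (U \<inter> S, \<kappa>)) ` A"

definition prod_charts ::
  "('a, 'd) chart set \<Rightarrow> ('b, 'e) chart set \<Rightarrow> ('a \<times> 'b, 'd \<times> 'e) chart set" where
  "prod_charts A B = (\<lambda>((U, \<kappa>), (U', \<kappa>')). (U \<times> U', map_prod \<kappa> \<kappa>')) ` (A \<times> B)"

definition c1_map ::
  "'a::topological_space set \<Rightarrow> ('a, 'd::euclidean_space) chart set \<Rightarrow>
   'b::topological_space set \<Rightarrow> ('b, 'e::euclidean_space) chart set \<Rightarrow> ('a \<Rightarrow> 'b) \<Rightarrow> bool"
  where
  "c1_map M A N B h \<longleftrightarrow>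
     h ` M \<subseteq> N \<and> continuous_on M h \<and>
     (\<forall>(U, \<kappa>)\<in>A. \<forall>(U', \<kappa>')\<in>B.
        c1_on (\<kappa> ` (U \<inter> h -` U')) (\<kappa>' \<circ> h \<circ> inv_into U \<kappa>))"

definition c1_diffeo ::
  "'a::topological_space set \<Rightarrow> ('a, 'd::euclidean_space) chart set \<Rightarrow>
   'b::topological_space set \<Rightarrow> ('b, 'e::euclidean_space) chart set \<Rightarrow> ('a \<Rightarrow> 'b) \<Rightarrow> bool"
  where
  "c1_diffeo M A N B h \<longleftrightarrow>
     bij_betw h M N \<and> c1_map M A N B h \<and> c1_map N B M A (inv_into M h)"

text \<open>
  On an abstract manifold the number \<open>|det D\<phi>(z)|\<close> refers to a volume density: \<open>\<rho> (U, \<kappa>)\<close> is the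
  density of the volume element in the chart \<open>\<kappa>\<close>, for instance \<open>sqrt (det g)\<close> for a
  Riemannian metric \<open>g\<close>.  On a subset of Euclidean space with the identity as its only chart one
  takes \<open>\<rho> = 1\<close> and obtains the usual Jacobian determinant.
\<close>

definition volume_density ::
  "('a::topological_space, real ^ 'k::finite) chart set \<Rightarrow>
   (('a, real ^ 'k) chart \<Rightarrow> 'a \<Rightarrow> real) \<Rightarrow> bool"
  where
  "volume_density A \<rho> \<longleftrightarrow>
     (\<forall>(U, \<kappa>)\<in>A. continuous_on U (\<rho> (U, \<kappa>)) \<and> (\<forall>z\<in>U. 0 < \<rho> (U, \<kappa>) z)) \<and>
     (\<forall>(U, \<kappa>)\<in>A. \<forall>(U', \<kappa>')\<in>A. \<forall>z\<in>U \<inter> U'. \<forall>D.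
        has_c1_jacobian (\<kappa> ` (U \<inter> U')) (\<kappa>' \<circ> inv_into U \<kappa>) (\<kappa> z) D \<longrightarrow>
        \<rho> (U, \<kappa>) z = \<rho> (U', \<kappa>') z * \<bar>det (matrix (blinfun_apply D))\<bar>)"

text \<open>
  \<open>abs_det_D A \<rho> \<phi> z\<close> is \<open>|det D\<phi>(z)|\<close>.  For a C1 map \<open>\<phi>\<close> of a space with regular charts into
  itself it does not depend on the charts \<open>\<kappa>\<close> at \<open>z\<close> and \<open>\<kappa>'\<close> at \<open>\<phi> z\<close>.
\<close>

definition abs_det_D ::
  "('a, real ^ 'k::finite) chart set \<Rightarrow> (('a, real ^ 'k) chart \<Rightarrow> 'a \<Rightarrow> real) \<Rightarrow>
   ('a \<Rightarrow> 'a) \<Rightarrow> 'a \<Rightarrow> real"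
  where
  "abs_det_D A \<rho> \<phi> z =
     (THE r. \<exists>U \<kappa> U' \<kappa>' D. (U, \<kappa>) \<in> A \<and> (U', \<kappa>') \<in> A \<and> z \<in> U \<and> \<phi> z \<in> U' \<and>
        has_c1_jacobian (\<kappa> ` (U \<inter> \<phi> -` U')) (\<kappa>' \<circ> \<phi> \<circ> inv_into U \<kappa>) (\<kappa> z) D \<and>
        r = \<rho> (U', \<kappa>') (\<phi> z) * \<bar>det (matrix (blinfun_apply D))\<bar> / \<rho> (U, \<kappa>) z)"

definition Delta ::
  "'a::topological_space set \<Rightarrow> ('a, real ^ 'k::finite) chart set \<Rightarrow>
   (('a, real ^ 'k) chart \<Rightarrow> 'a \<Rightarrow> real) \<Rightarrow> ('a \<Rightarrow> 'a) set"
  where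
  "Delta Z A \<rho> = {\<phi>. c1_diffeo Z A Z A \<phi> \<and> (\<exists>c. \<forall>z\<in>Z. abs_det_D A \<rho> \<phi> z = c)}"

definition const_abs_det_D ::
  "'a set \<Rightarrow> ('a, real ^ 'k::finite) chart set \<Rightarrow>
   (('a, real ^ 'k) chart \<Rightarrow> 'a \<Rightarrow> real) \<Rightarrow> ('a \<Rightarrow> 'a) \<Rightarrow> real"
  where
  "const_abs_det_D Z A \<rho> \<phi> = (THE c. \<forall>z\<in>Z. abs_det_D A \<rho> \<phi> z = c)"

text \<open>
  For measures \<open>\<mu>\<close> with \<open>\<mu> Z \<noteq> 0\<close> the defining equation with \<open>B = Z\<close> forces \<open>\<Psi>\<close> to be positive at
  the relevant arguments, so that \<open>ennreal\<close> does not truncate.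
\<close>

definition modular_character ::
  "'a::topological_space set \<Rightarrow> ('a, real ^ 'k::finite) chart set \<Rightarrow>
   (('a, real ^ 'k) chart \<Rightarrow> 'a \<Rightarrow> real) \<Rightarrow> 'a measure \<Rightarrow> (real \<Rightarrow> real) \<Rightarrow> bool"
  where
  "modular_character Z A \<rho> \<mu> \<Psi> \<longleftrightarrow>
     (\<forall>\<phi>\<in>Delta Z A \<rho>. \<forall>B\<in>sets \<mu>.
        emeasure \<mu> (\<phi> ` B) = ennreal (\<Psi> (const_abs_det_D Z A \<rho> \<phi>)) * emeasure \<mu> B)"

definition topological_group :: "('g, 'm) monoid_scheme \<Rightarrow> 'g topology \<Rightarrow> bool" where
  "topological_group G T \<longleftrightarrow>
     group G \<and> topspace T = carrier G \<and>
     continuous_map (prod_topology T T) T (\<lambda>(a, b). a \<otimes>\<^bsub>G\<^esub> b) \<and>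
     continuous_map T T (\<lambda>a. inv\<^bsub>G\<^esub> a)"

definition fiber :: "'x set \<Rightarrow> ('x \<Rightarrow> 'z) \<Rightarrow> 'z \<Rightarrow> 'x set" where
  "fiber X \<pi> z = {x\<in>X. \<pi> x = z}"

locale fiber_bundle =
  fixes X :: "'x::{second_countable_topology,t2_space} set"
    and AX :: "('x, 'd::euclidean_space) chart set"
    and Z :: "'z::{second_countable_topology,t2_space} set"
    and AZ :: "('z, 'k::euclidean_space) chart set"
    and Y :: "'y::{second_countable_topology,t2_space} set"
    and AY :: "('y, 'e::euclidean_space) chart set"
    and \<pi> :: "'x \<Rightarrow> 'z"
    and G :: "('g, 'm) monoid_scheme"
    and TG :: "'g topology"
    and act :: "'g \<Rightarrow> 'y \<Rightarrow> 'y"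
  assumes c1_total: "c1_space X AX"
    and c1_base: "c1_space Z AZ"
    and c1_typical_fiber: "c1_space Y AY"
    and continuous_proj: "continuous_on X \<pi>"
    and surj_proj: "\<pi> ` X = Z"
    and structure_group: "topological_group G TG"
    and action: "group_action G Y act"
    and continuous_action:
      "continuous_map (prod_topology TG (top_of_set Y)) (top_of_set Y) (\<lambda>(a, y). act a y)"

locale locally_trivial_fiber_bundle = fiber_bundle X AX Z AZ Y AY \<pi> G TG act
  for X :: "'x::{second_countable_topology,t2_space} set"
    and AX :: "('x, 'd::euclidean_space) chart set"
    and Z :: "'z::{second_countable_topology,t2_space} set"
    and AZ :: "('z, 'k::euclidean_space) chart set"
    and Y :: "'y::{second_countable_topology,t2_space} set"
    and AY :: "('y, 'e::euclidean_space) chart set"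
    and \<pi> :: "'x \<Rightarrow> 'z"
    and G :: "('g, 'm) monoid_scheme"
    and TG :: "'g topology"
    and act :: "'g \<Rightarrow> 'y \<Rightarrow> 'y" +
  fixes J :: "'j set"
    and V :: "'j \<Rightarrow> 'z set"
    and \<psi> :: "'j \<Rightarrow> 'z \<times> 'y \<Rightarrow> 'x"
  assumes open_V: "\<And>j. j \<in> J \<Longrightarrow> openin (top_of_set Z) (V j)"
    and cover_V: "(\<Union>j\<in>J. V j) = Z"
    and diffeo: "\<And>j. j \<in> J \<Longrightarrow>
      c1_diffeo (V j \<times> Y) (prod_charts (restrict_charts (V j) AZ) AY)
        {x\<in>X. \<pi> x \<in> V j} (restrict_charts {x\<in>X. \<pi> x \<in> V j} AX) (\<psi> j)"
    and proj_triv: "\<And>j z y. j \<in> J \<Longrightarrow> z \<in> V j \<Longrightarrow> y \<in> Y \<Longrightarrow> \<pi> (\<psi> j (z, y)) = z"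
    and diffeo_fiber: "\<And>j z. j \<in> J \<Longrightarrow> z \<in> V j \<Longrightarrow>
      c1_diffeo Y AY (fiber X \<pi> z) (restrict_charts (fiber X \<pi> z) AX) (\<lambda>y. \<psi> j (z, y))"
    and transition: "\<And>i j z. i \<in> J \<Longrightarrow> j \<in> J \<Longrightarrow> z \<in> V i \<inter> V j \<Longrightarrow>
      \<exists>a\<in>carrier G. \<forall>y\<in>Y. inv_into Y (\<lambda>y'. \<psi> j (z, y')) (\<psi> i (z, y)) = act a y"

definition borel_measure_on :: "'a::topological_space set \<Rightarrow> 'a measure \<Rightarrow> bool" where
  "borel_measure_on S M \<longleftrightarrow> sets M = sets (restrict_space borel S)"

definition group_invariant ::
  "('g, 'm) monoid_scheme \<Rightarrow> ('g \<Rightarrow> 'y \<Rightarrow> 'y) \<Rightarrow> 'y measure \<Rightarrow> bool" where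
  "group_invariant G act \<nu> \<longleftrightarrow> (\<forall>a\<in>carrier G. distr \<nu> \<nu> (act a) = \<nu>)"

definition fiber_measure ::
  "'x::topological_space set \<Rightarrow> ('x \<Rightarrow> 'z) \<Rightarrow> ('z \<times> 'y \<Rightarrow> 'x) \<Rightarrow> 'y measure \<Rightarrow> 'z \<Rightarrow> 'x measure"
  where
  "fiber_measure X \<pi> \<psi>j \<nu> z =
     distr \<nu> (restrict_space borel (fiber X \<pi> z)) (\<lambda>y. \<psi>j (z, y))"

text \<open>
  The equation is imposed for every \<open>j\<close> with \<open>\<pi>(A) \<subseteq> V j\<close>; if \<open>\<nu>\<close> is invariant under the structure
  group, its right-hand side is the same for all these \<open>j\<close>.  The integral is over \<open>\<pi>(A)\<close>, where
  \<open>\<psi> j\<close> is a trivialization; the integrand of \<open>\<integral>\<^sup>+\<close> is measurable even if \<open>\<pi>(A)\<close> is not, because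
  the fibers over \<open>V j - \<pi>(A)\<close> do not meet \<open>A\<close>.
\<close>

definition local_product_measure ::
  "'x::topological_space set \<Rightarrow> ('x \<Rightarrow> 'z) \<Rightarrow> 'j set \<Rightarrow> ('j \<Rightarrow> 'z set) \<Rightarrow>
   ('j \<Rightarrow> 'z \<times> 'y \<Rightarrow> 'x) \<Rightarrow> 'y measure \<Rightarrow> 'z measure \<Rightarrow> 'x measure \<Rightarrow> bool"
  where
  "local_product_measure X \<pi> J V \<psi> \<nu> \<mu> lam \<longleftrightarrow>
     borel_measure_on X lam \<and>
     (\<forall>j\<in>J. \<forall>A\<in>sets lam. \<pi> ` A \<subseteq> V j \<longrightarrow>
        emeasure lam A =
          (\<integral>\<^sup>+z. emeasure (fiber_measure X \<pi> (\<psi> j) \<nu> z) (fiber X \<pi> z \<inter> A)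
               * indicator (\<pi> ` A) z \<partial>\<mu>))"

definition probability_density :: "'a measure \<Rightarrow> ('a \<Rightarrow> real) \<Rightarrow> bool" where
  "probability_density M f \<longleftrightarrow>
     f \<in> borel_measurable M \<and> (\<forall>x\<in>space M. 0 \<le> f x) \<and> prob_space (density M (\<lambda>x. ennreal (f x)))"

text \<open>
  The law of \<open>f(X)\<close>, for \<open>X\<close> with density \<open>f\<close> with respect to \<open>M\<close>, is the image of \<open>density M f\<close>
  under \<open>f\<close>.
\<close>

definition F_equivalent :: "'a measure \<Rightarrow> ('a \<Rightarrow> real) \<Rightarrow> ('a \<Rightarrow> real) \<Rightarrow> bool" where
  "F_equivalent M f1 f2 \<longleftrightarrow>
     distr (density M (\<lambda>x. ennreal (f1 x))) borel f1 = distr (density M (\<lambda>x. ennreal (f2 x))) borel f2"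

definition admits_F_equivalence :: "'a measure \<Rightarrow> ('a \<Rightarrow> real) set \<Rightarrow> bool" where
  "admits_F_equivalence M F \<longleftrightarrow>
     (\<forall>f\<in>F. probability_density M f) \<and> (\<forall>f1\<in>F. \<forall>f2\<in>F. F_equivalent M f1 f2)"

end

theory Submission
  imports Defs
begin

text \<open>
  Gluing local trivializations turns the total space, up to measure, into the product
  \<open>Z \<times> Y\<close>, on which \<open>f \<phi>\<close> becomes \<open>(z, y) \<mapsto> C * g (\<phi> y z)\<close>.  For fixed \<open>y\<close>, the
  modular character says that \<open>\<phi> y\<close> maps \<open>\<mu>\<close> to \<open>\<Psi> (\<bar>det D (\<phi> y)\<^sup>-\<^sup>1\<bar>)\<close> times \<open>\<mu>\<close>, so by Tonelli the
  integral of \<open>h (f \<phi>)\<close> is the integral of \<open>\<Psi> (\<bar>det D (\<phi> y)\<^sup>-\<^sup>1\<bar>)\<close> over the fiber times that of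
  \<open>h (C * g)\<close> over the base.  The condition on \<open>\<Phi>\<close> makes the first factor \<open>1 / C\<close>, and the result
  no longer depends on \<open>\<phi>\<close>.  The modular character may be applied to \<open>(\<phi> y)\<^sup>-\<^sup>1\<close> because, by the
  chain rule, inverses of elements of \<open>Delta\<close> are again in \<open>Delta\<close>.
\<close>

subsection \<open>Jacobian determinants in charts\<close>

lemma has_c1_jacobian_cong:
  assumes "has_c1_jacobian S f x D" "T \<subseteq> S" "\<And>y. y \<in> T \<Longrightarrow> f y = h y"
  shows "has_c1_jacobian T h x D"
proof -
  obtain W F F' where *: "open W" "x \<in> W"
    "\<forall>y\<in>W. (F has_derivative blinfun_apply (F' y)) (at y)"
    "continuous_on W F'" "\<forall>y\<in>S \<inter> W. F y = f y" "D = F' x"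
    using assms(1) unfolding has_c1_jacobian_def by auto
  moreover have "\<forall>y\<in>T \<inter> W. F y = h y"
    using * assms(2,3) by (metis Int_iff subsetD)
  ultimately show ?thesis
    unfolding has_c1_jacobian_def by metis
qed

lemma has_c1_jacobian_ident: "has_c1_jacobian S (\<lambda>y. y) x id_blinfun"
  unfolding has_c1_jacobian_def
  by (rule exI[of _ UNIV], rule exI[of _ "\<lambda>y. y"], rule exI[of _ "\<lambda>_. id_blinfun"]) auto

text \<open>Local extensions of \<open>f\<close> and \<open>h\<close> compose on the open set of
  points that the extension of \<open>f\<close> sends into the domain of the extension of
  \<open>h\<close>; there the usual chain rule applies, and the derivative stays continuous because
  composition of bounded linear maps is bilinear and bounded.\<close>

lemma has_c1_jacobian_compose:
  assumes f: "has_c1_jacobian S f x D" and h: "has_c1_jacobian T h (f x) E"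
    and "f ` S \<subseteq> T" "x \<in> S"
  shows "has_c1_jacobian S (h \<circ> f) x (E o\<^sub>L D)"
proof -
  obtain W F F' where F: "open W" "x \<in> W"
    "\<And>y. y \<in> W \<Longrightarrow> (F has_derivative blinfun_apply (F' y)) (at y)"
    "continuous_on W F'" "\<forall>y\<in>S \<inter> W. F y = f y" "D = F' x"
    using f unfolding has_c1_jacobian_def by auto
  obtain W2 H H' where H: "open W2" "f x \<in> W2"
    "\<And>y. y \<in> W2 \<Longrightarrow> (H has_derivative blinfun_apply (H' y)) (at y)"
    "continuous_on W2 H'" "\<forall>y\<in>T \<inter> W2. H y = h y" "E = H' (f x)"
    using h unfolding has_c1_jacobian_def by auto
  have contF: "continuous_on W F"
    using F(3) by (meson continuous_at_imp_continuous_on has_derivative_continuous)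
  let ?U = "W \<inter> F -` W2"
  have Fx: "F x = f x"
    using F assms(4) by auto
  have "open ?U"
    using contF F(1) H(1) by (simp add: continuous_on_open_vimage Int_commute)
  moreover have "x \<in> ?U"
    using F(2) H(2) Fx by simp
  moreover have "\<forall>y\<in>?U. ((H \<circ> F) has_derivative blinfun_apply (H' (F y) o\<^sub>L F' y)) (at y)"
  proof
    fix y assume "y \<in> ?U"
    then have "((H \<circ> F) has_derivative (blinfun_apply (H' (F y)) \<circ> blinfun_apply (F' y))) (at y)"
      using F(3) H(3) by (intro diff_chain_at) auto
    then show "((H \<circ> F) has_derivative blinfun_apply (H' (F y) o\<^sub>L F' y)) (at y)"
      by (simp add: blinfun_compose.rep_eq)
  qed
  moreover have "continuous_on ?U (\<lambda>y. H' (F y) o\<^sub>L F' y)"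
  proof (rule bounded_bilinear.continuous_on[OF bounded_bilinear_blinfun_compose])
    show "continuous_on ?U (\<lambda>y. H' (F y))"
      by (rule continuous_on_compose2[OF H(4)])
        (use contF continuous_on_subset in blast, auto)
    show "continuous_on ?U F'"
      using F(4) continuous_on_subset by blast
  qed
  moreover have "\<forall>y\<in>S \<inter> ?U. (H \<circ> F) y = (h \<circ> f) y"
    using F(5) H(5) assms(3) by auto
  moreover have "E o\<^sub>L D = H' (F x) o\<^sub>L F' x"
    using F H Fx by simp
  ultimately show ?thesis
    unfolding has_c1_jacobian_def by (intro exI conjI)
qed

text \<open>Two extensions agree on the interior of \<open>S\<close> near \<open>x\<close>, so their
  derivatives agree there. Were they different at \<open>x\<close>, by continuity they would differ
  on a whole neighborhood of \<open>x\<close>, which contains interior points of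
  \<open>S\<close>.\<close>

lemma has_c1_jacobian_unique:
  assumes f: "has_c1_jacobian S f x D" and h: "has_c1_jacobian S f x E"
    and x: "x \<in> closure (interior S)"
  shows "D = E"
proof (rule ccontr)
  assume neq: "D \<noteq> E"
  obtain W F F' where F: "open W" "x \<in> W"
    "\<And>y. y \<in> W \<Longrightarrow> (F has_derivative blinfun_apply (F' y)) (at y)"
    "continuous_on W F'" "\<forall>y\<in>S \<inter> W. F y = f y" "D = F' x"
    using f unfolding has_c1_jacobian_def by auto
  obtain W2 H H' where H: "open W2" "x \<in> W2"
    "\<And>y. y \<in> W2 \<Longrightarrow> (H has_derivative blinfun_apply (H' y)) (at y)"
    "continuous_on W2 H'" "\<forall>y\<in>S \<inter> W2. H y = f y" "E = H' x"
    using h unfolding has_c1_jacobian_def by auto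
  let ?W = "W \<inter> W2"
  let ?N = "?W \<inter> (\<lambda>y. F' y - H' y) -` (- {0})"
  have "continuous_on ?W (\<lambda>y. F' y - H' y)"
    using F(4) H(4) by (intro continuous_on_diff) (auto intro: continuous_on_subset)
  then have "open ?N"
    using F(1) H(1) by (intro continuous_open_preimage) auto
  moreover have "x \<in> ?N"
    using F H neq by auto
  ultimately obtain y where "y \<in> ?N" "y \<in> interior S"
    using x open_Int_closure_eq_empty by blast
  then have y: "y \<in> W" "y \<in> W2" "F' y \<noteq> H' y" "y \<in> interior S"
    by auto
  have "(H has_derivative blinfun_apply (F' y)) (at y)"
    using F(3)[OF y(1)]
  proof (rule has_derivative_transform_within_open)
    show "open (?W \<inter> interior S)" "y \<in> ?W \<inter> interior S"
      using F(1) H(1) y by auto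
    show "F v = H v" if "v \<in> ?W \<inter> interior S" for v
      using that F(5) H(5) interior_subset[of S] by (auto simp: subset_iff)
  qed
  then have "blinfun_apply (F' y) = blinfun_apply (H' y)"
    using H(3)[OF y(2)] has_derivative_unique by blast
  with y(3) show False
    by (auto simp: blinfun_apply_inject)
qed

lemma abs_det_blinfun_compose:
  fixes D E :: "(real ^ 'k::finite) \<Rightarrow>\<^sub>L (real ^ 'k)"
  shows "\<bar>det (matrix (blinfun_apply (E o\<^sub>L D)))\<bar> =
    \<bar>det (matrix (blinfun_apply E))\<bar> * \<bar>det (matrix (blinfun_apply D))\<bar>"
  by (simp add: blinfun_compose.rep_eq matrix_compose bounded_linear.linear
      blinfun.bounded_linear_right det_mul abs_mult)

lemma det_id_blinfun: "det (matrix (blinfun_apply (id_blinfun :: (real ^ 'k::finite) \<Rightarrow>\<^sub>L (real ^ 'k)))) = 1"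
  by (simp add: id_blinfun.rep_eq matrix_id_mat_1[unfolded id_def])

text \<open>This is the relation that occurs under the description operator of
  \<open>abs_det_D\<close>, with charts kept as pairs. For the identity in place of
  \<open>\<phi>\<close> it gives the Jacobians of the transition maps, so that one chain rule serves
  both.\<close>

definition chart_jacobian ::
  "('a, 'd::euclidean_space) chart \<Rightarrow> ('a, 'e::euclidean_space) chart \<Rightarrow> ('a \<Rightarrow> 'a) \<Rightarrow>
    'a \<Rightarrow> ('d \<Rightarrow>\<^sub>L 'e) \<Rightarrow> bool"
  where
  "chart_jacobian c c' \<phi> z D \<longleftrightarrow>
     has_c1_jacobian (snd c ` (fst c \<inter> \<phi> -` fst c'))
       (snd c' \<circ> \<phi> \<circ> inv_into (fst c) (snd c)) (snd c z) D"

section \<open>The determinant relative to a volume density, and inverses in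
  \<open>Delta\<close>\<close>

locale regular_volume_space =
  fixes Z :: "'a::{second_countable_topology,t2_space} set"
    and A :: "('a, real ^ 'k::finite) chart set"
    and \<rho> :: "('a, real ^ 'k) chart \<Rightarrow> 'a \<Rightarrow> real"
  assumes c1: "c1_space Z A"
    and regular: "regular_charts A"
    and volume: "volume_density A \<rho>"
begin

lemma chart_openin: "c \<in> A \<Longrightarrow> openin (top_of_set Z) (fst c)"
  using bspec[OF c1[unfolded c1_space_def, THEN conjunct2, THEN conjunct1], of c]
  by (simp add: split_def)

lemma chart_homeomorphism:
  "c \<in> A \<Longrightarrow> homeomorphism (fst c) (snd c ` fst c) (snd c) (inv_into (fst c) (snd c))"
  using c1 by (auto simp: c1_space_def split: prod.splits)

lemma chart_inv [simp]: "c \<in> A \<Longrightarrow> x \<in> fst c \<Longrightarrow> inv_into (fst c) (snd c) (snd c x) = x"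
  using chart_homeomorphism homeomorphism_apply1 by blast

lemma chart_at: "z \<in> Z \<Longrightarrow> \<exists>c\<in>A. z \<in> fst c"
  using c1 by (force simp: c1_space_def)

lemma density_pos: "c \<in> A \<Longrightarrow> z \<in> fst c \<Longrightarrow> 0 < \<rho> c z"
  using bspec[OF volume[unfolded volume_density_def, THEN conjunct1], of c]
  by (simp add: split_def)

lemma density_transform:
  assumes "c \<in> A" "c' \<in> A" "z \<in> fst c" "z \<in> fst c'" "chart_jacobian c c' (\<lambda>x. x) z D"
  shows "\<rho> c z = \<rho> c' z * \<bar>det (matrix (blinfun_apply D))\<bar>"
proof -
  have "has_c1_jacobian (snd c ` (fst c \<inter> fst c')) (snd c' \<circ> inv_into (fst c) (snd c)) (snd c z) D"
    using assms(5) unfolding chart_jacobian_def by (rule has_c1_jacobian_cong) auto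
  then show ?thesis
    using volume assms(1-4) unfolding volume_density_def
    by (metis (mono_tags, lifting) Int_iff case_prodD prod.collapse)
qed

text \<open>Jacobians are compared on overlaps of chart domains, so regularity is needed for these
  smaller sets. The image of \<open>S\<close> is the image of the chart cut by an open
  \<open>T\<close>, and an open set meeting the closure of a set stays in the closure of the
  intersection.\<close>

lemma chart_image_regular:
  assumes c: "c \<in> A" and S: "openin (top_of_set Z) S" "S \<subseteq> fst c"
  shows "snd c ` S \<subseteq> closure (interior (snd c ` S))"
proof -
  let ?K = "snd c ` fst c"
  have "openin (top_of_set (fst c)) S"
    using S chart_openin[OF c] by (meson openin_imp_subset openin_subset_trans)
  then have "openin (top_of_set ?K) (snd c ` S)"
    using homeomorphism_imp_open_map[OF chart_homeomorphism[OF c]] by blast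
  then obtain T where T: "open T" "snd c ` S = ?K \<inter> T"
    by (auto simp: openin_open)
  have "?K \<subseteq> closure (interior ?K)"
    using regular c by (auto simp: regular_charts_def split: prod.splits)
  then have "snd c ` S \<subseteq> T \<inter> closure (interior ?K)"
    using T by auto
  also have "\<dots> \<subseteq> closure (T \<inter> interior ?K)"
    using T(1) by (rule open_Int_closure_subset)
  also have "T \<inter> interior ?K = interior (snd c ` S)"
    using T by (simp add: interior_open Int_commute)
  finally show ?thesis .
qed

lemma openin_preimage_chart:
  assumes \<phi>: "c1_map Z A Z A \<phi>" and S: "openin (top_of_set Z) S" "openin (top_of_set Z) S'"
  shows "openin (top_of_set Z) (S \<inter> \<phi> -` S')"
proof -
  have "openin (top_of_set Z) (Z \<inter> \<phi> -` S')"
    using \<phi> S(2) by (intro continuous_openin_preimage) (auto simp: c1_map_def)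
  then have "openin (top_of_set Z) (S \<inter> (Z \<inter> \<phi> -` S'))"
    using S(1) by blast
  moreover have "S \<inter> (Z \<inter> \<phi> -` S') = S \<inter> \<phi> -` S'"
    using openin_imp_subset[OF S(1)] by auto
  ultimately show ?thesis by simp
qed

lemma chart_jacobian_exists:
  assumes "c1_map Z A Z A \<phi>" "c \<in> A" "c' \<in> A" "z \<in> fst c" "\<phi> z \<in> fst c'"
  shows "\<exists>D. chart_jacobian c c' \<phi> z D"
proof -
  have "c1_on (snd c ` (fst c \<inter> \<phi> -` fst c')) (snd c' \<circ> \<phi> \<circ> inv_into (fst c) (snd c))"
    using assms(1-3) by (auto simp: c1_map_def split: prod.splits)
  then show ?thesis
    using assms(4,5) by (auto simp: c1_on_def chart_jacobian_def)
qed

lemma c1_map_ident: "c1_map Z A Z A (\<lambda>x. x)"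
proof -
  have "c1_on (snd c ` (fst c \<inter> fst c')) (snd c' \<circ> inv_into (fst c) (snd c))"
    if "c \<in> A" "c' \<in> A" for c c'
    using c1 that by (auto simp: c1_space_def split: prod.splits)
  then show ?thesis
    by (auto simp: c1_map_def comp_def split: prod.splits)
qed

text \<open>The conclusion is not of the form \<open>chart_jacobian c c''\<close>: points that
  \<open>\<phi>\<close> sends outside the intermediate chart \<open>c'\<close> have to be removed
  from the domain.\<close>

lemma chart_jacobian_chain:
  assumes "chart_jacobian c c' \<phi> z D" "chart_jacobian c' c'' \<xi> (\<phi> z) E"
    and c: "c \<in> A" "c' \<in> A" and z: "z \<in> fst c" "\<phi> z \<in> fst c'" "\<xi> (\<phi> z) \<in> fst c''"
  shows "has_c1_jacobian (snd c ` (fst c \<inter> \<phi> -` (fst c' \<inter> \<xi> -` fst c'')))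
    (snd c'' \<circ> \<xi> \<circ> \<phi> \<circ> inv_into (fst c) (snd c)) (snd c z) (E o\<^sub>L D)"
proof -
  let ?S = "snd c ` (fst c \<inter> \<phi> -` (fst c' \<inter> \<xi> -` fst c''))"
  have D: "has_c1_jacobian ?S (snd c' \<circ> \<phi> \<circ> inv_into (fst c) (snd c)) (snd c z) D"
    using assms(1) unfolding chart_jacobian_def by (rule has_c1_jacobian_cong) auto
  have E: "has_c1_jacobian (snd c' ` (fst c' \<inter> \<xi> -` fst c''))
     (snd c'' \<circ> \<xi> \<circ> inv_into (fst c') (snd c'))
     ((snd c' \<circ> \<phi> \<circ> inv_into (fst c) (snd c)) (snd c z)) E"
    using assms by (simp add: chart_jacobian_def)
  have "has_c1_jacobian ?S ((snd c'' \<circ> \<xi> \<circ> inv_into (fst c') (snd c')) \<circ>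
      (snd c' \<circ> \<phi> \<circ> inv_into (fst c) (snd c))) (snd c z) (E o\<^sub>L D)"
    using c z by (intro has_c1_jacobian_compose[OF D E]) auto
  then show ?thesis
    by (rule has_c1_jacobian_cong) (use c in auto)
qed

text \<open>
  Passing from one pair of charts to another multiplies the determinant of the Jacobian by those
  of the transition maps, which the volume density compensates.
\<close>

lemma abs_det_chart_independent:
  assumes \<phi>: "c1_map Z A Z A \<phi>"
    and c: "c1 \<in> A" "c1' \<in> A" "c2 \<in> A" "c2' \<in> A"
    and z: "z \<in> fst c1" "\<phi> z \<in> fst c1'" "z \<in> fst c2" "\<phi> z \<in> fst c2'"
    and D: "chart_jacobian c1 c1' \<phi> z D1" "chart_jacobian c2 c2' \<phi> z D2"
  shows "\<rho> c1' (\<phi> z) * \<bar>det (matrix (blinfun_apply D1))\<bar> / \<rho> c1 z =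
    \<rho> c2' (\<phi> z) * \<bar>det (matrix (blinfun_apply D2))\<bar> / \<rho> c2 z"
proof -
  obtain T where T: "chart_jacobian c1 c2 (\<lambda>x. x) z T"
    using chart_jacobian_exists[OF c1_map_ident, of c1 c2 z] c z by auto
  obtain T' where T': "chart_jacobian c1' c2' (\<lambda>x. x) (\<phi> z) T'"
    using chart_jacobian_exists[OF c1_map_ident, of c1' c2' "\<phi> z"] c z by auto
  let ?O = "(fst c1 \<inter> fst c2) \<inter> \<phi> -` (fst c1' \<inter> fst c2')"
  let ?h = "snd c2' \<circ> \<phi> \<circ> inv_into (fst c1) (snd c1)"
  have "openin (top_of_set Z) ?O"
    using c chart_openin by (intro openin_preimage_chart[OF \<phi>] openin_Int) auto
  then have reg: "snd c1 z \<in> closure (interior (snd c1 ` ?O))"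
    using chart_image_regular[OF c(1), of ?O] z by auto
  \<comment> \<open>The coordinate expression \<open>?h\<close> is differentiated along two routes
    from \<open>c1\<close> to \<open>c2'\<close>: through \<open>c1'\<close>, changing charts last,
    and through \<open>c2\<close>, changing charts first.\<close>
  have "has_c1_jacobian (snd c1 ` ?O) ?h (snd c1 z) (T' o\<^sub>L D1)"
    using chart_jacobian_chain[OF D(1) T' c(1,2) z(1,2,4)]
    by (rule has_c1_jacobian_cong) auto
  moreover have "has_c1_jacobian (snd c1 ` ?O) ?h (snd c1 z) (D2 o\<^sub>L T)"
    using chart_jacobian_chain[OF T D(2) c(1,3) z(1,3,4)]
    by (rule has_c1_jacobian_cong) auto
  ultimately have "T' o\<^sub>L D1 = D2 o\<^sub>L T"
    using reg by (rule has_c1_jacobian_unique)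
  then have "\<bar>det (matrix (blinfun_apply T'))\<bar> * \<bar>det (matrix (blinfun_apply D1))\<bar> =
      \<bar>det (matrix (blinfun_apply D2))\<bar> * \<bar>det (matrix (blinfun_apply T))\<bar>"
    by (metis abs_det_blinfun_compose)
  moreover have "\<rho> c1 z = \<rho> c2 z * \<bar>det (matrix (blinfun_apply T))\<bar>"
    using density_transform T c z by blast
  moreover have "\<rho> c1' (\<phi> z) = \<rho> c2' (\<phi> z) * \<bar>det (matrix (blinfun_apply T'))\<bar>"
    using density_transform T' c z by blast
  moreover have "\<rho> c1 z > 0" "\<rho> c2 z > 0"
    using density_pos c z by auto
  ultimately show ?thesis
    by (auto simp: field_simps)
qed

text \<open>Independence of the charts makes the description in \<open>abs_det_D\<close> unique, so
  that any pair of charts and any Jacobian in them may be used for computation.\<close>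

lemma abs_det_D_eq:
  assumes \<phi>: "c1_map Z A Z A \<phi>" and c: "c \<in> A" "c' \<in> A" "z \<in> fst c" "\<phi> z \<in> fst c'"
    and D: "chart_jacobian c c' \<phi> z D"
  shows "abs_det_D A \<rho> \<phi> z = \<rho> c' (\<phi> z) * \<bar>det (matrix (blinfun_apply D))\<bar> / \<rho> c z"
  unfolding abs_det_D_def
proof (rule the_equality)
  show "\<exists>U \<kappa> U' \<kappa>' Da. (U, \<kappa>) \<in> A \<and> (U', \<kappa>') \<in> A \<and> z \<in> U \<and> \<phi> z \<in> U' \<and>
      has_c1_jacobian (\<kappa> ` (U \<inter> \<phi> -` U')) (\<kappa>' \<circ> \<phi> \<circ> inv_into U \<kappa>) (\<kappa> z) Da \<and>
      \<rho> c' (\<phi> z) * \<bar>det (matrix (blinfun_apply D))\<bar> / \<rho> c z =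
      \<rho> (U', \<kappa>') (\<phi> z) * \<bar>det (matrix (blinfun_apply Da))\<bar> / \<rho> (U, \<kappa>) z"
    using c D unfolding chart_jacobian_def by (metis prod.collapse)
next
  fix r
  assume "\<exists>U \<kappa> U' \<kappa>' D. (U, \<kappa>) \<in> A \<and> (U', \<kappa>') \<in> A \<and> z \<in> U \<and> \<phi> z \<in> U' \<and>
      has_c1_jacobian (\<kappa> ` (U \<inter> \<phi> -` U')) (\<kappa>' \<circ> \<phi> \<circ> inv_into U \<kappa>) (\<kappa> z) D \<and>
      r = \<rho> (U', \<kappa>') (\<phi> z) * \<bar>det (matrix (blinfun_apply D))\<bar> / \<rho> (U, \<kappa>) z"
  then obtain U \<kappa> U' \<kappa>' E where E: "(U, \<kappa>) \<in> A" "(U', \<kappa>') \<in> A" "z \<in> U" "\<phi> z \<in> U'"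
      "chart_jacobian (U, \<kappa>) (U', \<kappa>') \<phi> z E"
      "r = \<rho> (U', \<kappa>') (\<phi> z) * \<bar>det (matrix (blinfun_apply E))\<bar> / \<rho> (U, \<kappa>) z"
    unfolding chart_jacobian_def by auto
  then show "r = \<rho> c' (\<phi> z) * \<bar>det (matrix (blinfun_apply D))\<bar> / \<rho> c z"
    using abs_det_chart_independent[OF \<phi> E(1,2) c(1,2) _ _ c(3,4) E(5) D] by simp
qed

lemma abs_det_D_inv_into:
  assumes \<phi>: "c1_diffeo Z A Z A \<phi>" and z: "z \<in> Z"
  shows "abs_det_D A \<rho> (inv_into Z \<phi>) (\<phi> z) = inverse (abs_det_D A \<rho> \<phi> z)"
proof -
  let ?\<xi> = "inv_into Z \<phi>"
  have bij: "bij_betw \<phi> Z Z" and m: "c1_map Z A Z A \<phi>" "c1_map Z A Z A ?\<xi>"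
    using \<phi> by (auto simp: c1_diffeo_def)
  have inv: "?\<xi> (\<phi> x) = x" if "x \<in> Z" for x
    using bij that by (meson bij_betw_inv_into_left)
  have "\<phi> z \<in> Z"
    using bij z by (auto simp: bij_betw_def)
  with z obtain c c' where c: "c \<in> A" "c' \<in> A" "z \<in> fst c" "\<phi> z \<in> fst c'"
    using chart_at by blast
  obtain D where D: "chart_jacobian c c' \<phi> z D"
    using chart_jacobian_exists[OF m(1) c] by blast
  have \<xi>: "?\<xi> (\<phi> z) \<in> fst c"
    using inv z c by simp
  \<comment> \<open>The inverse is read in the same two charts in reverse order:
    \<open>?\<xi> \<circ> \<phi>\<close> then becomes the identity in the chart \<open>c\<close>,
    and the values of \<open>\<rho>\<close> cancel in the product of the two determinants.\<close>
  obtain E where E: "chart_jacobian c' c ?\<xi> (\<phi> z) E"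
    using chart_jacobian_exists[OF m(2) c(2,1,4) \<xi>] by blast
  let ?O = "fst c \<inter> \<phi> -` (fst c' \<inter> ?\<xi> -` fst c)"
  have "openin (top_of_set Z) ?O"
    using c chart_openin by (intro openin_preimage_chart m) auto
  then have reg: "snd c z \<in> closure (interior (snd c ` ?O))"
    using chart_image_regular[OF c(1), of ?O] c \<xi> by auto
  have "has_c1_jacobian (snd c ` ?O) (\<lambda>y. y) (snd c z) (E o\<^sub>L D)"
    using chart_jacobian_chain[OF D E c(1,2,3,4) \<xi>]
  proof (rule has_c1_jacobian_cong)
    show "(snd c \<circ> ?\<xi> \<circ> \<phi> \<circ> inv_into (fst c) (snd c)) y = y" if "y \<in> snd c ` ?O" for y
      using that c inv openin_imp_subset[OF chart_openin[OF c(1)]] by auto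
  qed auto
  then have "E o\<^sub>L D = id_blinfun"
    using has_c1_jacobian_ident reg by (rule has_c1_jacobian_unique)
  then have "\<bar>det (matrix (blinfun_apply E))\<bar> * \<bar>det (matrix (blinfun_apply D))\<bar> = 1"
    by (metis abs_det_blinfun_compose det_id_blinfun abs_one)
  moreover have "\<rho> c z > 0" "\<rho> c' (\<phi> z) > 0"
    using density_pos c by auto
  moreover have "abs_det_D A \<rho> \<phi> z = \<rho> c' (\<phi> z) * \<bar>det (matrix (blinfun_apply D))\<bar> / \<rho> c z"
    by (rule abs_det_D_eq[OF m(1) c D])
  moreover have "abs_det_D A \<rho> ?\<xi> (\<phi> z) = \<rho> c z * \<bar>det (matrix (blinfun_apply E))\<bar> / \<rho> c' (\<phi> z)"
    using abs_det_D_eq[OF m(2) c(2,1,4) \<xi> E] inv[OF z] by simp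
  ultimately have "abs_det_D A \<rho> \<phi> z * abs_det_D A \<rho> ?\<xi> (\<phi> z) = 1"
    by (simp add: mult.commute)
  then show ?thesis
    by (rule inverse_unique[symmetric])
qed

lemma inv_into_in_Delta:
  assumes \<phi>: "\<phi> \<in> Delta Z A \<rho>"
  shows "inv_into Z \<phi> \<in> Delta Z A \<rho>"
proof -
  let ?\<xi> = "inv_into Z \<phi>"
  have d: "c1_diffeo Z A Z A \<phi>"
    using \<phi> by (simp add: Delta_def)
  have bij: "bij_betw \<phi> Z Z" and m: "c1_map Z A Z A \<phi>" "c1_map Z A Z A ?\<xi>"
    using d by (auto simp: c1_diffeo_def)
  have bij': "bij_betw ?\<xi> Z Z"
    using bij by (rule bij_betw_inv_into)
  have eq: "inv_into Z ?\<xi> z = \<phi> z" if "z \<in> Z" for z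
    using inv_into_inv_into_eq[OF bij] that by simp
  \<comment> \<open>For \<open>?\<xi>\<close> to be a diffeomorphism, its own inverse must be C1.
    This double inverse is known to equal \<open>\<phi>\<close> only on \<open>Z\<close>, so the
    property is carried over from \<open>\<phi>\<close> chart by chart.\<close>
  have "c1_map Z A Z A (inv_into Z ?\<xi>)"
    unfolding c1_map_def
  proof (intro conjI ballI)
    show "inv_into Z ?\<xi> ` Z \<subseteq> Z"
      using eq m(1) by (auto simp: c1_map_def)
    show "continuous_on Z (inv_into Z ?\<xi>)"
      using eq m(1) by (auto simp: c1_map_def cong: continuous_on_cong)
    show "case c of (U, \<kappa>) \<Rightarrow> \<forall>(U', \<kappa>')\<in>A.
        c1_on (\<kappa> ` (U \<inter> inv_into Z ?\<xi> -` U')) (\<kappa>' \<circ> inv_into Z ?\<xi> \<circ> inv_into U \<kappa>)"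
      if c: "c \<in> A" for c
    proof (clarsimp split: prod.split)
      fix U \<kappa> U' \<kappa>' assume "c = (U, \<kappa>)" and c': "(U', \<kappa>') \<in> A"
      then have U: "(U, \<kappa>) \<in> A" "U \<subseteq> Z"
        using c openin_imp_subset[OF chart_openin[OF c]] by auto
      have *: "c1_on (\<kappa> ` (U \<inter> \<phi> -` U')) (\<kappa>' \<circ> \<phi> \<circ> inv_into U \<kappa>)"
        using m(1) U(1) c' by (auto simp: c1_map_def)
      have S: "U \<inter> inv_into Z ?\<xi> -` U' = U \<inter> \<phi> -` U'"
        using eq U by auto
      show "c1_on (\<kappa> ` (U \<inter> inv_into Z ?\<xi> -` U')) (\<kappa>' \<circ> inv_into Z ?\<xi> \<circ> inv_into U \<kappa>)"
        unfolding c1_on_def S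
      proof
        fix x assume x: "x \<in> \<kappa> ` (U \<inter> \<phi> -` U')"
        then obtain D where
          "has_c1_jacobian (\<kappa> ` (U \<inter> \<phi> -` U')) (\<kappa>' \<circ> \<phi> \<circ> inv_into U \<kappa>) x D"
          using * by (auto simp: c1_on_def)
        then have "has_c1_jacobian (\<kappa> ` (U \<inter> \<phi> -` U')) (\<kappa>' \<circ> inv_into Z ?\<xi> \<circ> inv_into U \<kappa>) x D"
        proof (rule has_c1_jacobian_cong)
          show "(\<kappa>' \<circ> \<phi> \<circ> inv_into U \<kappa>) y = (\<kappa>' \<circ> inv_into Z ?\<xi> \<circ> inv_into U \<kappa>) y"
            if "y \<in> \<kappa> ` (U \<inter> \<phi> -` U')" for y
            using that eq U by (auto simp: inv_into_into subset_iff)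
        qed auto
        then show "\<exists>D. has_c1_jacobian (\<kappa> ` (U \<inter> \<phi> -` U'))
            (\<kappa>' \<circ> inv_into Z ?\<xi> \<circ> inv_into U \<kappa>) x D" ..
      qed
    qed
  qed
  moreover obtain a where "\<forall>z\<in>Z. abs_det_D A \<rho> \<phi> z = a"
    using \<phi> by (auto simp: Delta_def)
  \<comment> \<open>Each \<open>w\<close> in \<open>Z\<close> is \<open>\<phi> z\<close> for some
    \<open>z\<close> in \<open>Z\<close>, so the reciprocal rule covers all of
    \<open>Z\<close>.\<close>
  then have "\<forall>w\<in>Z. abs_det_D A \<rho> ?\<xi> w = inverse a"
    using abs_det_D_inv_into[OF d] bij by (metis bij_betw_def imageE)
  ultimately show ?thesis
    using bij' m(2) by (auto simp: Delta_def c1_diffeo_def)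
qed

end

subsection \<open>The local product measure as an image of a product measure\<close>

lemma space_borel_measure_on: "borel_measure_on S M \<Longrightarrow> space M = S"
  unfolding borel_measure_on_def by (drule sets_eq_imp_space_eq) (simp add: space_restrict_space)

lemma measurable_borel_measure_on:
  assumes "borel_measure_on S M"
  shows "measurable N M = measurable N (restrict_space borel S)"
    and "measurable M N = measurable (restrict_space borel S) N"
  using assms by (auto simp: borel_measure_on_def intro!: measurable_cong_sets)

lemma openin_sets_borel_measure_on:
  assumes "borel_measure_on S M" "openin (top_of_set S) U"
  shows "U \<in> sets M"
proof -
  obtain T where "open T" "U = S \<inter> T"
    using assms(2) by (auto simp: openin_open)
  then show ?thesis
    using assms(1) by (auto simp: borel_measure_on_def sets_restrict_space)
qed

section \<open>Elements of \<open>Delta\<close> acting on the base measure\<close>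

context regular_volume_space
begin

lemma Delta_measurable:
  assumes \<mu>: "borel_measure_on Z \<mu>" and \<phi>: "\<phi> \<in> Delta Z A \<rho>"
  shows "\<phi> \<in> measurable \<mu> \<mu>"
proof -
  have "continuous_on Z \<phi>" "\<phi> ` Z \<subseteq> Z"
    using \<phi> by (auto simp: Delta_def c1_diffeo_def c1_map_def)
  then show ?thesis
    unfolding measurable_borel_measure_on[OF \<mu>]
    by (intro measurable_restrict_space2 borel_measurable_continuous_on_restrict)
      (auto simp: space_restrict_space)
qed

text \<open>A pushforward measures preimages, while the modular character speaks of images. The
  preimage of \<open>B\<close> under \<open>\<phi>\<close> is its image under the inverse, whence
  the determinant of the inverse in the factor.\<close>

lemma distr_Delta:
  assumes \<mu>: "borel_measure_on Z \<mu>" and \<Psi>: "modular_character Z A \<rho> \<mu> \<Psi>"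
    and \<phi>: "\<phi> \<in> Delta Z A \<rho>"
  shows "distr \<mu> \<mu> \<phi> =
    scale_measure (ennreal (\<Psi> (const_abs_det_D Z A \<rho> (inv_into Z \<phi>)))) \<mu>"
proof (rule measure_eqI)
  fix B assume "B \<in> sets (distr \<mu> \<mu> \<phi>)"
  then have B: "B \<in> sets \<mu>" by simp
  have Z: "space \<mu> = Z"
    using \<mu> by (rule space_borel_measure_on)
  have bij: "bij_betw \<phi> Z Z"
    using \<phi> by (simp add: Delta_def c1_diffeo_def)
  have "B \<subseteq> Z"
    using B Z sets.sets_into_space by blast
  then have "inv_into Z \<phi> ` B = \<phi> -` B \<inter> Z"
    using bij by (auto simp: bij_betw_def inv_into_into f_inv_into_f subset_iff intro!: rev_image_eqI)
  then have "emeasure (distr \<mu> \<mu> \<phi>) B = emeasure \<mu> (inv_into Z \<phi> ` B)"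
    using emeasure_distr[OF Delta_measurable[OF \<mu> \<phi>] B] Z by simp
  then show "emeasure (distr \<mu> \<mu> \<phi>) B = emeasure
      (scale_measure (ennreal (\<Psi> (const_abs_det_D Z A \<rho> (inv_into Z \<phi>)))) \<mu>) B"
    using \<Psi> inv_into_in_Delta[OF \<phi>] B by (simp add: modular_character_def)
qed simp

text \<open>Since \<open>\<phi>\<close> maps \<open>Z\<close> onto itself, \<open>B = Z\<close> in
  the defining equation excludes a factor that \<open>ennreal\<close> truncates to 0. This allows
  passing between \<open>ennreal\<close> and real integrals of \<open>\<Psi>\<close>.\<close>

lemma modular_character_pos:
  assumes \<mu>: "borel_measure_on Z \<mu>" and \<Psi>: "modular_character Z A \<rho> \<mu> \<Psi>"
    and \<phi>: "\<phi> \<in> Delta Z A \<rho>" and nz: "emeasure \<mu> Z \<noteq> 0"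
  shows "0 < \<Psi> (const_abs_det_D Z A \<rho> \<phi>)"
proof -
  have "Z \<in> sets \<mu>"
    using space_borel_measure_on[OF \<mu>] sets.top by metis
  moreover have "\<phi> ` Z = Z"
    using \<phi> by (simp add: Delta_def c1_diffeo_def bij_betw_def)
  ultimately have "emeasure \<mu> Z = ennreal (\<Psi> (const_abs_det_D Z A \<rho> \<phi>)) * emeasure \<mu> Z"
    using \<Psi> \<phi> by (metis modular_character_def)
  then have "ennreal (\<Psi> (const_abs_det_D Z A \<rho> \<phi>)) \<noteq> 0"
    using nz by auto
  then show ?thesis
    by (simp add: ennreal_eq_0_iff not_le)
qed

end

section \<open>Gluing the trivializations of a bundle\<close>

context locally_trivial_fiber_bundle
begin

lemma triv_continuous: "j \<in> J \<Longrightarrow> continuous_on (V j \<times> Y) (\<psi> j)"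
  using diffeo by (auto simp: c1_diffeo_def c1_map_def)

lemma triv_in_total: "j \<in> J \<Longrightarrow> z \<in> V j \<Longrightarrow> y \<in> Y \<Longrightarrow> \<psi> j (z, y) \<in> X"
  using diffeo[of j] by (auto simp: c1_diffeo_def c1_map_def)

lemma inv_triv:
  assumes "j \<in> J" "z \<in> V j" "y \<in> Y"
  shows "inv_into Y (\<lambda>y. \<psi> j (z, y)) (\<psi> j (z, y)) = y"
  using diffeo_fiber[OF assms(1,2)] assms(3)
  by (auto simp: c1_diffeo_def bij_betw_def intro!: inv_into_f_eq)

text \<open>By Lindelof, as the base is second countable. An enumeration by all natural numbers,
  possibly with repetitions, exists because a cover of a nonempty \<open>Z\<close> has a
  member.\<close>

lemma countable_subcover:
  assumes "Z \<noteq> {}"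
  obtains j :: "nat \<Rightarrow> 'j" where "range j \<subseteq> J" "(\<Union>n. V (j n)) = Z"
proof -
  obtain \<V> where \<V>: "\<V> \<subseteq> V ` J" "countable \<V>" "\<Union>\<V> = \<Union>(V ` J)"
    using Lindelof_openin[of "V ` J" Z] open_V by auto
  have UN: "\<Union>\<V> = Z"
    unfolding \<V>(3) by (rule cover_V)
  with assms have "\<V> \<noteq> {}"
    by blast
  then have r: "range (from_nat_into \<V>) = \<V>"
    using \<V>(2) by (rule range_from_nat_into)
  have "\<exists>i\<in>J. V i = from_nat_into \<V> n" for n
    using \<V>(1) r by (metis imageE rangeI subsetD)
  then obtain j where "\<And>n. j n \<in> J" "\<And>n. V (j n) = from_nat_into \<V> n"
    by metis
  moreover from this(2) have "(\<Union>n. V (j n)) = Z"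
    using UN r by simp
  ultimately show thesis
    by (intro that[of j]) auto
qed

text \<open>Continuity gives measurability for the Borel sets of the product space; by second
  countability these are generated by rectangles, as in the product measure. \<open>W\<close> is
  meant to be a piece of a Borel partition of the base.\<close>

lemma triv_measurable:
  assumes \<nu>: "borel_measure_on Y \<nu>" and \<mu>: "borel_measure_on Z \<mu>" and lam: "borel_measure_on X lam"
    and j: "j \<in> J" and W: "W \<subseteq> V j"
  shows "\<psi> j \<in> measurable (restrict_space (\<mu> \<Otimes>\<^sub>M \<nu>) (W \<times> Y)) lam"
proof -
  have "(\<lambda>z. z) \<in> measurable \<mu> borel" "(\<lambda>y. y) \<in> measurable \<nu> borel"
    unfolding measurable_borel_measure_on(2)[OF \<mu>] measurable_borel_measure_on(2)[OF \<nu>]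
    by (auto intro: measurable_restrict_space1)
  then have "(\<lambda>p. (fst p, snd p)) \<in> measurable (\<mu> \<Otimes>\<^sub>M \<nu>) (borel \<Otimes>\<^sub>M borel)"
    by (intro measurable_Pair) (auto intro: measurable_compose[OF measurable_fst] measurable_compose[OF measurable_snd])
  then have "(\<lambda>p. p) \<in> measurable (\<mu> \<Otimes>\<^sub>M \<nu>) borel"
    by (simp add: borel_prod)
  then have "(\<lambda>p. p) \<in> measurable (restrict_space (\<mu> \<Otimes>\<^sub>M \<nu>) (W \<times> Y)) (restrict_space borel (W \<times> Y))"
    by (rule measurable_restrict_space3) auto
  moreover have "continuous_on (W \<times> Y) (\<psi> j)"
    using triv_continuous[OF j] W by (auto intro: continuous_on_subset)
  then have "\<psi> j \<in> measurable (restrict_space borel (W \<times> Y)) (restrict_space borel X)"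
    using j W triv_in_total
    by (intro measurable_restrict_space2 borel_measurable_continuous_on_restrict)
      (auto simp: space_restrict_space)
  ultimately show ?thesis
    unfolding measurable_borel_measure_on(1)[OF lam] by (rule measurable_compose)
qed

text \<open>This pulls the fiber part of \<open>A\<close> back to a slice in \<open>Y\<close>, the
  form in which the product measure integrates over the base.\<close>

lemma emeasure_fiber_measure:
  assumes \<nu>: "borel_measure_on Y \<nu>" and j: "j \<in> J" and z: "z \<in> V j"
    and A: "A \<in> sets (restrict_space borel X)"
  shows "emeasure (fiber_measure X \<pi> (\<psi> j) \<nu> z) (fiber X \<pi> z \<inter> A) = emeasure \<nu> {y\<in>Y. \<psi> j (z, y) \<in> A}"
proof -
  have in_fiber: "\<psi> j (z, y) \<in> fiber X \<pi> z" if "y \<in> Y" for y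
    using that j z triv_in_total proj_triv by (auto simp: fiber_def)
  have "continuous_on Y (\<lambda>y. \<psi> j (z, y))"
    using z by (intro continuous_on_compose2[OF triv_continuous[OF j]]) (auto intro!: continuous_intros)
  then have m: "(\<lambda>y. \<psi> j (z, y)) \<in> measurable \<nu> (restrict_space borel (fiber X \<pi> z))"
    unfolding measurable_borel_measure_on(2)[OF \<nu>] using in_fiber
    by (intro measurable_restrict_space2 borel_measurable_continuous_on_restrict)
      (auto simp: space_restrict_space)
  have "fiber X \<pi> z \<inter> A \<in> sets (restrict_space borel (fiber X \<pi> z))"
    using A by (auto simp: sets_restrict_space fiber_def)
  then show ?thesis
    using in_fiber unfolding fiber_measure_def
    by (subst emeasure_distr[OF m])
      (auto simp: space_borel_measure_on[OF \<nu>] intro!: arg_cong[where f = "emeasure \<nu>"])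
qed

text \<open>
  Gluing the trivializations along a countable Borel partition of the base turns the local
  product measure into the image of a global product measure.
\<close>

lemma local_product_measure_eq_distr:
  assumes \<nu>: "borel_measure_on Y \<nu>" "sigma_finite_measure \<nu>" and \<mu>: "borel_measure_on Z \<mu>"
    and lam: "local_product_measure X \<pi> J V \<psi> \<nu> \<mu> lam" and "Z \<noteq> {}"
  obtains \<theta> where "\<theta> \<in> measurable (\<mu> \<Otimes>\<^sub>M \<nu>) lam" "lam = distr (\<mu> \<Otimes>\<^sub>M \<nu>) lam \<theta>"
    "\<And>z y. z \<in> Z \<Longrightarrow> \<exists>j\<in>J. z \<in> V j \<and> \<theta> (z, y) = \<psi> j (z, y)"
proof -
  interpret \<nu>: sigma_finite_measure \<nu> by fact
  have borel_lam: "borel_measure_on X lam"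
    using lam by (simp add: local_product_measure_def)
  have sp: "space \<nu> = Y" "space \<mu> = Z" "space lam = X"
    using \<nu>(1) \<mu> borel_lam by (simp_all add: space_borel_measure_on)
  obtain j :: "nat \<Rightarrow> 'j" where "range j \<subseteq> J" and j_UN: "(\<Union>n. V (j n)) = Z"
    using countable_subcover[OF \<open>Z \<noteq> {}\<close>] .
  then have j: "j n \<in> J" for n
    by blast
  \<comment> \<open>The equation defining \<open>lam\<close> only concerns sets lying over a single
    \<open>V j\<close>, so the base is cut into disjoint Borel pieces, each inside one
    \<open>V (j n)\<close>.\<close>
  define W where "W = disjointed (\<lambda>n. V (j n))"
  have W_sub: "W n \<subseteq> V (j n)" for n
    by (auto simp: W_def disjointed_def)
  have W_UN: "(\<Union>n. W n) = Z"
    unfolding W_def UN_disjointed_eq by (rule j_UN)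
  have "range (\<lambda>n. V (j n)) \<subseteq> sets \<mu>"
    using openin_sets_borel_measure_on[OF \<mu> open_V[OF j]] by (rule image_subsetI)
  then have "range W \<subseteq> sets \<mu>"
    unfolding W_def by (rule sets.range_disjointed_sets)
  then have W_sets: "W n \<in> sets \<mu>" for n
    by blast
  have W_disj: "disjoint_family W"
    by (simp add: W_def disjoint_family_disjointed)
  \<comment> \<open>The least \<open>n\<close> with \<open>z\<close> in \<open>V (j n)\<close> is
    the index of the piece \<open>W n\<close> containing \<open>z\<close>; hence on each piece
    \<open>\<theta>\<close> is a single trivialization.\<close>
  define \<theta> where "\<theta> p = \<psi> (j (LEAST n. fst p \<in> V (j n))) p" for p
  have \<theta>: "\<theta> (z, y) = \<psi> (j n) (z, y)" if "z \<in> W n" for z y n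
  proof -
    have "(LEAST n. z \<in> V (j n)) = n"
      using that by (intro Least_equality) (auto simp: W_def disjointed_def not_less[symmetric])
    then show ?thesis by (simp add: \<theta>_def)
  qed
  have \<theta>_triv: "\<theta> (z, y) \<in> X" "\<pi> (\<theta> (z, y)) = z" if "z \<in> Z" "y \<in> Y" for z y
  proof -
    obtain n where n: "z \<in> W n"
      using \<open>z \<in> Z\<close> unfolding W_UN[symmetric] by (rule UN_E)
    then have "z \<in> V (j n)"
      using W_sub by auto
    with n show "\<theta> (z, y) \<in> X" "\<pi> (\<theta> (z, y)) = z"
      using \<theta>[OF n] triv_in_total[OF j] proj_triv[OF j] that by auto
  qed
  have \<theta>_meas: "\<theta> \<in> measurable (\<mu> \<Otimes>\<^sub>M \<nu>) lam"
  proof (rule measurable_piecewise_restrict[where C = "range (\<lambda>n. W n \<times> Y)"])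
    fix \<Omega> assume "\<Omega> \<in> range (\<lambda>n. W n \<times> Y)"
    then obtain n where \<Omega>: "\<Omega> = W n \<times> Y" by auto
    have "W n \<times> Y \<in> sets (\<mu> \<Otimes>\<^sub>M \<nu>)"
      using W_sets sp(1) by (metis pair_measureI sets.top)
    then show "\<Omega> \<inter> space (\<mu> \<Otimes>\<^sub>M \<nu>) \<in> sets (\<mu> \<Otimes>\<^sub>M \<nu>)"
      using \<Omega> by auto
    have "\<psi> (j n) \<in> measurable (restrict_space (\<mu> \<Otimes>\<^sub>M \<nu>) \<Omega>) lam"
      unfolding \<Omega> using \<nu>(1) \<mu> borel_lam j W_sub by (rule triv_measurable)
    moreover have "\<theta> p = \<psi> (j n) p" if "p \<in> space (restrict_space (\<mu> \<Otimes>\<^sub>M \<nu>) \<Omega>)" for p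
      using that \<theta> by (auto simp: \<Omega> space_restrict_space)
    ultimately show "\<theta> \<in> measurable (restrict_space (\<mu> \<Otimes>\<^sub>M \<nu>) \<Omega>) lam"
      using measurable_cong by blast
  next
    show "space (\<mu> \<Otimes>\<^sub>M \<nu>) \<subseteq> \<Union>(range (\<lambda>n. W n \<times> Y))"
      using W_UN sp by (auto simp: space_pair_measure)
  qed simp
  moreover have "lam = distr (\<mu> \<Otimes>\<^sub>M \<nu>) lam \<theta>"
  proof (rule measure_eqI)
    fix A assume A: "A \<in> sets lam"
    then have "A \<subseteq> X"
      using sets.sets_into_space sp(3) by blast
    have "\<pi> \<in> measurable lam \<mu>"
      unfolding measurable_borel_measure_on(1)[OF \<mu>] measurable_borel_measure_on(2)[OF borel_lam]
      using continuous_proj surj_proj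
      by (intro measurable_restrict_space2 borel_measurable_continuous_on_restrict)
        (auto simp: space_restrict_space)
    then have "A \<inter> (\<pi> -` W n \<inter> space lam) \<in> sets lam" for n
      using A W_sets by (intro sets.Int measurable_sets)
    moreover have "A \<inter> (\<pi> -` W n \<inter> space lam) = A \<inter> \<pi> -` W n" for n
      using \<open>A \<subseteq> X\<close> sp(3) by auto
    ultimately have An: "A \<inter> \<pi> -` W n \<in> sets lam" for n
      by simp
    have piece: "emeasure lam (A \<inter> \<pi> -` W n) = emeasure (distr (\<mu> \<Otimes>\<^sub>M \<nu>) lam \<theta>) (A \<inter> \<pi> -` W n)" for n
    proof -
      let ?A = "A \<inter> \<pi> -` W n"
      let ?B = "\<theta> -` ?A \<inter> space (\<mu> \<Otimes>\<^sub>M \<nu>)"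
      have "\<pi> ` ?A \<subseteq> V (j n)"
        using W_sub by auto
      then have "emeasure lam ?A = (\<integral>\<^sup>+z. emeasure (fiber_measure X \<pi> (\<psi> (j n)) \<nu> z) (fiber X \<pi> z \<inter> ?A)
          * indicator (\<pi> ` ?A) z \<partial>\<mu>)"
        using lam j An by (simp add: local_product_measure_def)
      \<comment> \<open>Over a point in the projection of \<open>?A\<close> the fiber measure is
        that of the slice of \<open>?B\<close>. Over any other point the indicator vanishes, and the
        slice is empty because \<open>\<theta> (z, y)\<close> lies over \<open>z\<close>.\<close>
      also have "\<dots> = (\<integral>\<^sup>+z. emeasure \<nu> (Pair z -` ?B) \<partial>\<mu>)"
      proof (rule nn_integral_cong)
        fix z assume "z \<in> space \<mu>"
        then have z: "z \<in> Z" by (simp add: sp)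
        show "emeasure (fiber_measure X \<pi> (\<psi> (j n)) \<nu> z) (fiber X \<pi> z \<inter> ?A) * indicator (\<pi> ` ?A) z =
          emeasure \<nu> (Pair z -` ?B)"
        proof (cases "z \<in> \<pi> ` ?A")
          case True
          then have zW: "z \<in> W n" by auto
          have "Pair z -` ?B = {y\<in>Y. \<psi> (j n) (z, y) \<in> ?A}"
            using \<theta>[OF zW] z by (auto simp: space_pair_measure sp)
          moreover have "?A \<in> sets (restrict_space borel X)"
            using An borel_lam by (simp add: borel_measure_on_def)
          ultimately show ?thesis
            using emeasure_fiber_measure[OF \<nu>(1) j, of z n ?A] zW W_sub[of n] True by auto
        next
          case False
          then have "Pair z -` ?B = {}"
            using \<theta>_triv(2)[OF z] by (force simp: space_pair_measure sp)
          then show ?thesis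
            using False by simp
        qed
      qed
      also have "\<dots> = emeasure (\<mu> \<Otimes>\<^sub>M \<nu>) ?B"
        using measurable_sets[OF \<theta>_meas An] by (rule \<nu>.emeasure_pair_measure_alt[symmetric])
      finally show ?thesis
        using emeasure_distr[OF \<theta>_meas An] by simp
    qed
    \<comment> \<open>Both measures are countably additive and agree on the part of \<open>A\<close>
      over each \<open>W n\<close>.\<close>
    have disj: "disjoint_family (\<lambda>n. A \<inter> \<pi> -` W n)"
      using W_disj by (auto simp: disjoint_family_on_def)
    have "A = (\<Union>n. A \<inter> \<pi> -` W n)"
      using W_UN \<open>A \<subseteq> X\<close> surj_proj by blast
    then show "emeasure lam A = emeasure (distr (\<mu> \<Otimes>\<^sub>M \<nu>) lam \<theta>) A"
      using suminf_emeasure[of "\<lambda>n. A \<inter> \<pi> -` W n" lam, OF _ disj] An piece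
        suminf_emeasure[of "\<lambda>n. A \<inter> \<pi> -` W n" "distr (\<mu> \<Otimes>\<^sub>M \<nu>) lam \<theta>", OF _ disj]
      by (simp add: image_subset_iff)
  qed simp
  moreover have "\<exists>i\<in>J. z \<in> V i \<and> \<theta> (z, y) = \<psi> i (z, y)" if "z \<in> Z" for z y
    using that \<theta> W_UN W_sub j by blast
  ultimately show thesis
    using that by blast
qed

end

subsection \<open>Laws of the densities\<close>

text \<open>
  With \<open>q y\<close> the factor by which \<open>\<phi> y\<close> transforms \<open>\<mu>\<close>, averaging over the fiber leaves an
  expression in which \<open>\<phi>\<close> no longer occurs.
\<close>

lemma nn_integral_eq_if_average_scaling:
  fixes g :: "'z \<Rightarrow> real" and h :: "real \<Rightarrow> ennreal"
  assumes "sigma_finite_measure \<mu>" "sigma_finite_measure \<nu>"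
    and \<theta>: "\<theta> \<in> measurable (\<mu> \<Otimes>\<^sub>M \<nu>) M" "M = distr (\<mu> \<Otimes>\<^sub>M \<nu>) M \<theta>"
    and f: "f \<in> borel_measurable M"
    and eq: "\<And>z y. z \<in> space \<mu> \<Longrightarrow> y \<in> space \<nu> \<Longrightarrow> f (\<theta> (z, y)) = C * g (\<phi> y z)"
    and \<phi>: "\<And>y. y \<in> space \<nu> \<Longrightarrow> \<phi> y \<in> measurable \<mu> \<mu>"
      "\<And>y. y \<in> space \<nu> \<Longrightarrow> distr \<mu> \<mu> (\<phi> y) = scale_measure (ennreal (q y)) \<mu>"
    and q: "\<And>y. y \<in> space \<nu> \<Longrightarrow> 0 \<le> q y" "(\<integral>y. C * q y \<partial>\<nu>) = 1"
    and C: "0 < C" and g: "g \<in> borel_measurable \<mu>" and h: "h \<in> borel_measurable borel"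
  shows "(\<integral>\<^sup>+x. h (f x) \<partial>M) = ennreal (1 / C) * (\<integral>\<^sup>+z. h (C * g z) \<partial>\<mu>)"
proof -
  interpret pair_sigma_finite \<mu> \<nu>
    using assms(1,2) by (simp add: pair_sigma_finite_def)
  let ?K = "\<integral>\<^sup>+z. h (C * g z) \<partial>\<mu>"
  have hg: "(\<lambda>z. h (C * g z)) \<in> borel_measurable \<mu>"
    using g h by measurable
  have hf: "(\<lambda>x. h (f x)) \<in> borel_measurable M"
    using f h by measurable
  \<comment> \<open>The integral of a function that is not integrable is 0 by convention, so the
    value 1 forces integrability.\<close>
  have int: "integrable \<nu> (\<lambda>y. C * q y)"
    using q(2) not_integrable_integral_eq by fastforce
  then have q_meas: "(\<lambda>y. ennreal (C * q y)) \<in> borel_measurable \<nu>"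
    by measurable
  \<comment> \<open>Measurability and integral of \<open>q\<close> on the space of
    \<open>\<nu>\<close> are recovered from those of \<open>C * q y\<close> by dividing by
    \<open>C\<close>.\<close>
  have scale: "ennreal (1 / C) * ennreal (C * q y) = ennreal (q y)" if "y \<in> space \<nu>" for y
    using C q(1)[OF that] by (simp flip: ennreal_mult)
  have "(\<integral>\<^sup>+y. ennreal (C * q y) \<partial>\<nu>) = 1"
    using nn_integral_eq_integral[OF int] q C by (simp add: AE_I2)
  then have "(\<integral>\<^sup>+y. ennreal (1 / C) * ennreal (C * q y) \<partial>\<nu>) = ennreal (1 / C)"
    using q_meas by (simp add: nn_integral_cmult)
  moreover have "(\<lambda>y. ennreal (1 / C) * ennreal (C * q y)) \<in> borel_measurable \<nu>"
    using q_meas by measurable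
  ultimately have q_int: "(\<integral>\<^sup>+y. ennreal (q y) \<partial>\<nu>) = ennreal (1 / C)"
    and q_meas': "(\<lambda>y. ennreal (q y)) \<in> borel_measurable \<nu>"
    by (simp_all only: nn_integral_cong[OF scale] measurable_cong[OF scale])
  have "(\<integral>\<^sup>+x. h (f x) \<partial>M) = (\<integral>\<^sup>+p. h (f (\<theta> p)) \<partial>(\<mu> \<Otimes>\<^sub>M \<nu>))"
    using hf by (subst \<theta>(2), subst nn_integral_distr[OF \<theta>(1)]) simp_all
  \<comment> \<open>The base is integrated first, so that \<open>\<phi> y\<close> acts as a change
    of variables with \<open>y\<close> fixed. Joint measurability comes from \<open>f\<close> and
    \<open>\<theta>\<close>; each \<open>\<phi> y\<close> is only measurable in
    \<open>z\<close>.\<close>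
  also have "\<dots> = (\<integral>\<^sup>+y. (\<integral>\<^sup>+z. h (f (\<theta> (z, y))) \<partial>\<mu>) \<partial>\<nu>)"
    by (rule nn_integral_snd[OF measurable_compose[OF \<theta>(1) hf], symmetric])
  also have "\<dots> = (\<integral>\<^sup>+y. ennreal (q y) * ?K \<partial>\<nu>)"
  proof (rule nn_integral_cong)
    fix y assume y: "y \<in> space \<nu>"
    have "(\<integral>\<^sup>+z. h (f (\<theta> (z, y))) \<partial>\<mu>) = (\<integral>\<^sup>+z. h (C * g (\<phi> y z)) \<partial>\<mu>)"
      using eq[OF _ y] by (intro nn_integral_cong) simp
    also have "\<dots> = (\<integral>\<^sup>+z. h (C * g z) \<partial>distr \<mu> \<mu> (\<phi> y))"
      using hg by (simp add: nn_integral_distr[OF \<phi>(1)[OF y]])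
    also have "\<dots> = ennreal (q y) * ?K"
      using hg by (simp add: \<phi>(2)[OF y] nn_integral_scale_measure)
    finally show "(\<integral>\<^sup>+z. h (f (\<theta> (z, y))) \<partial>\<mu>) = ennreal (q y) * ?K" .
  qed
  also have "\<dots> = ennreal (1 / C) * ?K"
    using q_meas' by (simp add: nn_integral_multc q_int)
  finally show ?thesis .
qed

text \<open>The choice \<open>h = ennreal\<close> in the integral formula yields total mass 1, and
  \<open>ennreal t * indicator S t\<close> as the value of \<open>h\<close> at \<open>t\<close>
  yields the mass that the law of \<open>f\<close> gives to \<open>S\<close>. The right-hand side is
  the same for all members of \<open>F\<close>, and so are the laws.\<close>

lemma admits_F_equivalenceI:
  fixes F :: "('a \<Rightarrow> real) set" and g :: "'b \<Rightarrow> real"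
  assumes F: "\<And>f. f \<in> F \<Longrightarrow> f \<in> borel_measurable M"
      "\<And>f x. f \<in> F \<Longrightarrow> x \<in> space M \<Longrightarrow> 0 \<le> f x"
    and eq: "\<And>f h. f \<in> F \<Longrightarrow> h \<in> borel_measurable borel \<Longrightarrow>
      (\<integral>\<^sup>+x. h (f x) \<partial>M) = ennreal (1 / C) * (\<integral>\<^sup>+z. h (C * g z) \<partial>\<mu>)"
    and C: "0 < C" and g: "probability_density \<mu> g"
  shows "admits_F_equivalence M F"
  unfolding admits_F_equivalence_def
proof (intro conjI ballI)
  fix f assume f: "f \<in> F"
  have g_meas: "g \<in> borel_measurable \<mu>" and g_nonneg: "\<And>z. z \<in> space \<mu> \<Longrightarrow> 0 \<le> g z"
    and "prob_space (density \<mu> (\<lambda>z. ennreal (g z)))"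
    using g by (auto simp: probability_density_def)
  then have "(\<integral>\<^sup>+z. ennreal (g z) \<partial>\<mu>) = 1"
    using prob_space.emeasure_space_1[of "density \<mu> (\<lambda>z. ennreal (g z))"]
    by (simp add: emeasure_density cong: nn_integral_cong)
  moreover have "(\<integral>\<^sup>+z. ennreal (C * g z) \<partial>\<mu>) = (\<integral>\<^sup>+z. ennreal C * ennreal (g z) \<partial>\<mu>)"
    using C g_nonneg by (intro nn_integral_cong) (simp add: ennreal_mult)
  ultimately have "(\<integral>\<^sup>+z. ennreal (C * g z) \<partial>\<mu>) = ennreal C"
    using g_meas by (simp add: nn_integral_cmult)
  then have "(\<integral>\<^sup>+x. ennreal (f x) \<partial>M) = 1"
    using eq[OF f, of ennreal] C by (simp flip: ennreal_mult)
  then have "prob_space (density M (\<lambda>x. ennreal (f x)))"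
    using F(1)[OF f] by (intro prob_spaceI) (simp add: emeasure_density cong: nn_integral_cong)
  then show "probability_density M f"
    using F f by (simp add: probability_density_def)
next
  fix f1 f2 assume f: "f1 \<in> F" "f2 \<in> F"
  have law: "emeasure (distr (density M (\<lambda>x. ennreal (f x))) borel f) S =
      ennreal (1 / C) * (\<integral>\<^sup>+z. ennreal (C * g z) * indicator S (C * g z) \<partial>\<mu>)"
    if f: "f \<in> F" and S[measurable]: "S \<in> sets borel" for f S
  proof -
    have [measurable]: "f \<in> borel_measurable M"
      using F(1) f .
    have "f -` S \<inter> space M \<in> sets M"
      by measurable
    then have "emeasure (distr (density M (\<lambda>x. ennreal (f x))) borel f) S =
        (\<integral>\<^sup>+x. ennreal (f x) * indicator (f -` S \<inter> space M) x \<partial>M)"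
      using S by (simp add: emeasure_distr emeasure_density)
    also have "\<dots> = (\<integral>\<^sup>+x. ennreal (f x) * indicator S (f x) \<partial>M)"
      by (intro nn_integral_cong) (simp add: indicator_def)
    also have "\<dots> = ennreal (1 / C) * (\<integral>\<^sup>+z. ennreal (C * g z) * indicator S (C * g z) \<partial>\<mu>)"
      by (intro eq[OF f, of "\<lambda>t. ennreal t * indicator S t"]) measurable
    finally show ?thesis .
  qed
  show "F_equivalent M f1 f2"
    unfolding F_equivalent_def by (rule measure_eqI) (use law f in simp_all)
qed

section \<open>Application to the densities on the bundle\<close>

theorem theorem5p4:
  fixes X :: "'x::{second_countable_topology,t2_space} set"
    and AX :: "('x, 'd::euclidean_space) chart set"
    and Z :: "'z::{second_countable_topology,t2_space} set"
    and AZ :: "('z, real ^ 'k::finite) chart set"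
    and Y :: "'y::{second_countable_topology,t2_space} set"
    and AY :: "('y, 'e::euclidean_space) chart set"
    and \<pi> :: "'x \<Rightarrow> 'z"
    and G :: "('g, 'm) monoid_scheme"
    and TG :: "'g topology"
    and act :: "'g \<Rightarrow> 'y \<Rightarrow> 'y"
    and J :: "'j set"
    and V :: "'j \<Rightarrow> 'z set"
    and \<psi> :: "'j \<Rightarrow> 'z \<times> 'y \<Rightarrow> 'x"
    and \<rho> :: "('z, real ^ 'k) chart \<Rightarrow> 'z \<Rightarrow> real"
    and \<nu> :: "'y measure"
    and \<mu> :: "'z measure"
    and lam :: "'x measure"
    and \<Psi> :: "real \<Rightarrow> real"
    and C :: real
    and g :: "'z \<Rightarrow> real"
    and \<Phi> :: "('y \<Rightarrow> 'z \<Rightarrow> 'z) set"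
    and f :: "('y \<Rightarrow> 'z \<Rightarrow> 'z) \<Rightarrow> 'x \<Rightarrow> real"
  assumes "contains_open_subset X AX \<or> (compact X \<and> c1_manifold X AX)"
    and "locally_trivial_fiber_bundle X AX Z AZ Y AY \<pi> G TG act J V \<psi>"
    and "compact Y"
    and "regular_charts AZ"
    and "volume_density AZ \<rho>"
    and "borel_measure_on Y \<nu>"
    and "0 < emeasure \<nu> Y" and "emeasure \<nu> Y < \<infinity>"
    and "group_invariant G act \<nu>"
    and "borel_measure_on Z \<mu>"
    and "sigma_finite_measure \<mu>"
    and "local_product_measure X \<pi> J V \<psi> \<nu> \<mu> lam"
    and "C = 1 / measure \<nu> Y"
    and "probability_density \<mu> g"
    and "modular_character Z AZ \<rho> \<mu> \<Psi>"
    and "\<forall>\<phi>\<in>\<Phi>. \<forall>y\<in>Y. \<phi> y \<in> Delta Z AZ \<rho>"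
    and "\<forall>\<phi>\<in>\<Phi>. f \<phi> \<in> borel_measurable lam"
    and "\<forall>\<phi>\<in>\<Phi>. \<forall>j\<in>J. \<forall>x\<in>X. \<pi> x \<in> V j \<longrightarrow>
           f \<phi> x = C * g (\<phi> (inv_into Y (\<lambda>y. \<psi> j (\<pi> x, y)) x) (\<pi> x))"
    and "\<Phi> \<subseteq> {\<phi>. (\<integral>y. C * \<Psi> (const_abs_det_D Z AZ \<rho> (inv_into Z (\<phi> y))) \<partial>\<nu>) = 1}"
  shows "admits_F_equivalence lam {f \<phi> | \<phi>. \<phi> \<in> \<Phi>}"
proof -
  note trivialized = assms(2) and \<nu> = assms(6) and \<mu> = assms(10) and lam = assms(12)
    and C_def = assms(13) and g = assms(14) and \<Psi> = assms(15) and in_Delta = assms(16)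
    and f_meas = assms(17) and f_eq = assms(18) and average = assms(19)
  interpret locally_trivial_fiber_bundle X AX Z AZ Y AY \<pi> G TG act J V \<psi>
    by (rule trivialized)
  interpret regular_volume_space Z AZ \<rho>
    using c1_base assms(4,5) by unfold_locales
  have space: "space \<nu> = Y" "space \<mu> = Z" "space lam = X"
    using \<nu> \<mu> lam by (simp_all add: space_borel_measure_on local_product_measure_def)
  interpret \<nu>: finite_measure \<nu>
    using assms(8) space by (intro finite_measureI) simp
  have C: "0 < C"
    using assms(7) space unfolding C_def by (simp add: \<nu>.emeasure_eq_measure)
  \<comment> \<open>A null measure carries no probability density \<open>g\<close>. This makes
    \<open>Z\<close> nonempty, as gluing requires, and the values of \<open>\<Psi>\<close>
    positive.\<close>
  have \<mu>_nz: "emeasure \<mu> Z \<noteq> 0"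
  proof
    assume "emeasure \<mu> Z = 0"
    then have "Z \<in> null_sets \<mu>"
      using sets.top[of \<mu>] space by (simp add: null_setsI)
    then have "emeasure (density \<mu> (\<lambda>z. ennreal (g z))) Z = 0"
      using g by (subst emeasure_density)
        (auto simp: probability_density_def nn_integral_null_set)
    moreover have "emeasure (density \<mu> (\<lambda>z. ennreal (g z))) Z = 1"
      using g prob_space.emeasure_space_1 space by (fastforce simp: probability_density_def)
    ultimately show False by simp
  qed
  then have "Z \<noteq> {}" by auto
  then obtain \<theta> where \<theta>: "\<theta> \<in> measurable (\<mu> \<Otimes>\<^sub>M \<nu>) lam" "lam = distr (\<mu> \<Otimes>\<^sub>M \<nu>) lam \<theta>"
      "\<And>z y. z \<in> Z \<Longrightarrow> \<exists>j\<in>J. z \<in> V j \<and> \<theta> (z, y) = \<psi> j (z, y)"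
    using local_product_measure_eq_distr[OF \<nu> \<nu>.sigma_finite_measure_axioms \<mu> lam] by metis
  show ?thesis
  proof (rule admits_F_equivalenceI[OF _ _ _ C g])
    fix f' assume "f' \<in> {f \<phi> |\<phi>. \<phi> \<in> \<Phi>}"
    then obtain \<phi> where \<phi>: "\<phi> \<in> \<Phi>" and f': "f' = f \<phi>" by auto
    show meas: "f' \<in> borel_measurable lam"
      using f_meas \<phi> f' by simp
    have D: "\<phi> y \<in> Delta Z AZ \<rho>" if "y \<in> Y" for y
      using in_Delta \<phi> that by simp
    have g_nonneg: "0 \<le> g z" if "z \<in> Z" for z
      using g that space by (simp add: probability_density_def)
    show "0 \<le> f' x" if "x \<in> space lam" for x
    proof -
      have "x \<in> X" "\<pi> x \<in> Z"
        using that space surj_proj by auto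
      then obtain j where j: "j \<in> J" "\<pi> x \<in> V j"
        using cover_V by auto
      let ?y = "inv_into Y (\<lambda>y. \<psi> j (\<pi> x, y)) x"
      \<comment> \<open>The fiber coordinate of \<open>x\<close> lies in \<open>Y\<close>, so the
        corresponding element of \<open>Delta\<close> keeps the base point in \<open>Z\<close>,
        where \<open>g\<close> is nonnegative.\<close>
      have "(\<lambda>y. \<psi> j (\<pi> x, y)) ` Y = fiber X \<pi> (\<pi> x)"
        using diffeo_fiber[OF j] by (simp add: c1_diffeo_def bij_betw_def)
      then have "?y \<in> Y"
        using \<open>x \<in> X\<close> by (intro inv_into_into) (auto simp: fiber_def)
      then have "\<phi> ?y (\<pi> x) \<in> Z"
        using measurable_space[OF Delta_measurable[OF \<mu> D]] \<open>\<pi> x \<in> Z\<close> space by blast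
      then show ?thesis
        using f_eq \<phi> j \<open>x \<in> X\<close> g_nonneg C by (simp add: f')
    qed
    fix h :: "real \<Rightarrow> ennreal" assume h: "h \<in> borel_measurable borel"
    show "(\<integral>\<^sup>+x. h (f' x) \<partial>lam) = ennreal (1 / C) * (\<integral>\<^sup>+z. h (C * g z) \<partial>\<mu>)"
    \<comment> \<open>The factor \<open>q y\<close> is the value of \<open>\<Psi>\<close> at the
      determinant of the inverse of \<open>\<phi> y\<close>, so its averaging condition is
      membership in the set bounding \<open>\<Phi>\<close>.\<close>
    proof (rule nn_integral_eq_if_average_scaling[OF assms(11) \<nu>.sigma_finite_measure_axioms
          \<theta>(1,2) meas _ _ _ _ _ C _ h])
      fix z y assume "z \<in> space \<mu>" "y \<in> space \<nu>"
      then have z: "z \<in> Z" and y: "y \<in> Y"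
        by (simp_all add: space)
      \<comment> \<open>Reading the density in the very trivialization that \<open>\<theta>\<close>
        uses at \<open>z\<close> returns the fiber coordinate \<open>y\<close> itself.\<close>
      obtain j where j: "j \<in> J" "z \<in> V j" and eq: "\<theta> (z, y) = \<psi> j (z, y)"
        using \<theta>(3)[OF z] by blast
      show "f' (\<theta> (z, y)) = C * g (\<phi> y z)"
        using f_eq \<phi> j triv_in_total[OF j y] proj_triv[OF j y] inv_triv[OF j y]
        by (simp add: f' eq)
    next
      fix y assume "y \<in> space \<nu>"
      then have y: "\<phi> y \<in> Delta Z AZ \<rho>"
        using D space by simp
      show "\<phi> y \<in> measurable \<mu> \<mu>"
        using \<mu> y by (rule Delta_measurable)
      show "distr \<mu> \<mu> (\<phi> y) =
          scale_measure (ennreal (\<Psi> (const_abs_det_D Z AZ \<rho> (inv_into Z (\<phi> y))))) \<mu>"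
        using \<mu> \<Psi> y by (rule distr_Delta)
      show "0 \<le> \<Psi> (const_abs_det_D Z AZ \<rho> (inv_into Z (\<phi> y)))"
        using modular_character_pos[OF \<mu> \<Psi> inv_into_in_Delta[OF y] \<mu>_nz] by simp
    next
      show "(\<integral>y. C * \<Psi> (const_abs_det_D Z AZ \<rho> (inv_into Z (\<phi> y))) \<partial>\<nu>) = 1"
        using average \<phi> by blast
      show "g \<in> borel_measurable \<mu>"
        using g by (simp add: probability_density_def)
    qed
  qed
qed

end
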